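(* Let $q$ be a prime power, $\mathbb{F}=\mathbb{F}_q$, $n\ge 1$ and $b\in\mathbb{F}$. Then \[ |\mathcal{C}^{*}_{*,b}|=\sum_{k=1}^{nq}(-1)^{k-1}\Bigg(\sum_{\substack{k_1+\cdots+k_n=k\\ 0\le k_j\le q}}\Big(\prod_{j=1}^{n}C(q,k_j)\Big)\,q^{\prod_{j=1}^{n}(q-k_j)}\Bigg). \]
   Context: $[n]=\{1,\dots,n\}$, $C(m,k)=\frac{m!}{k!(m-k)!}$. For $i\in[n]$ and $a,b\in\mathbb{F}$, $\mathcal{C}^i_{a,b}$ denotes the set of all functions $f:\mathbb{F}^n\to\mathbb{F}$ with $f(x_1,\dots,x_{i-1},a,x_{i+1},\dots,x_n)=b$ for all $(x_1,\dots,x_n)\in\mathbb{F}^n$. $\mathcal{C}^*_{*,b}=\bigcup_{i\in[n]}\bigcup_{a\in\mathbb{F}}\mathcal{C}^i_{a,b}$, the set of functions canalyzing in some variable with some canalyzing input value and canalyzed output value $b$. *)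

theory Defs
  imports "HOL-Analysis.Finite_Cartesian_Product"
begin

text \<open>The finite index type \<open>'n\<close> plays the role of \<open>{1,\<dots>,n}\<close>, so that
  \<open>n = CARD('n) \<ge> 1\<close>, and \<open>'a ^ 'n\<close> is the \<open>n\<close>-fold Cartesian power of \<open>'a\<close>.\<close>

definition canalyzing :: "'n::finite \<Rightarrow> 'a \<Rightarrow> 'a \<Rightarrow> ('a ^ 'n \<Rightarrow> 'a) set" where
  "canalyzing i a b = {f. \<forall>x. f (\<chi> j. if j = i then a else x $ j) = b}"

definition canalyzing_to :: "'a \<Rightarrow> ('a ^ 'n::finite \<Rightarrow> 'a) set" where
  "canalyzing_to b = (\<Union>i\<in>UNIV. \<Union>a\<in>UNIV. canalyzing i a b)"

end

theory Submission
  imports Defs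
begin

text \<open>A set of pairs (variable, canalyzing input) amounts to a family \<open>S j\<close> of sets of inputs.
  A function is canalyzing with output \<open>b\<close> for all these pairs iff it takes the value \<open>b\<close> off the box
  \<open>\<Prod>j. - S j\<close>, so there are \<open>q ^ (\<Prod>j. q - card (S j))\<close> such functions. Apply inclusion--exclusion
  over all families and group them by the cardinalities \<open>c j = card (S j)\<close>.\<close>

text \<open>Overwriting coordinate \<open>i\<close> by \<open>a\<close> fixes every \<open>x\<close>
  with \<open>x $ i = a\<close>, so the overwritten vectors are exactly these.\<close>

lemma canalyzing_iff:
  fixes f :: "'a ^ 'n::finite \<Rightarrow> 'a"
  shows "f \<in> canalyzing i a b \<longleftrightarrow> (\<forall>x. x $ i = a \<longrightarrow> f x = b)"
proof
  assume f: "f \<in> canalyzing i a b"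
  have "(\<chi> j. if j = i then x $ i else x $ j) = x" for x :: "'a ^ 'n"
    by (simp add: vec_eq_iff)
  then show "\<forall>x. x $ i = a \<longrightarrow> f x = b"
    using f unfolding canalyzing_def mem_Collect_eq by metis
qed (simp add: canalyzing_def)

lemma card_vec_box:
  fixes T :: "'n::finite \<Rightarrow> 'a::finite set"
  shows "card {x :: 'a ^ 'n. \<forall>j. x $ j \<in> T j} = (\<Prod>j\<in>UNIV. card (T j))"
proof -
  have "bij_betw vec_nth {x :: 'a ^ 'n. \<forall>j. x $ j \<in> T j} (PiE UNIV T)"
    by (rule bij_betwI[where g = vec_lambda]) (auto simp: PiE_UNIV_domain)
  then show ?thesis
    by (simp add: bij_betw_same_card card_PiE)
qed

text \<open>Off \<open>D\<close> the value is forced and on \<open>D\<close> it is free, so these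
  functions form a product of copies of \<open>{b}\<close> and \<open>UNIV\<close>.\<close>

lemma card_functions_constant_outside:
  fixes D :: "'x::finite set" and b :: "'a::finite"
  shows "card {f. \<forall>x. x \<notin> D \<longrightarrow> f x = b} = CARD('a) ^ card D"
proof -
  have "{f. \<forall>x. x \<notin> D \<longrightarrow> f x = b} = PiE UNIV (\<lambda>x. if x \<in> D then UNIV else {b})"
    by (simp add: PiE_UNIV_domain Pi_def set_eq_iff if_distrib[of "(\<in>) _"])
  then show ?thesis
    by (simp add: card_PiE if_distrib[of card] prod.If_cases)
qed

lemma card_Inter_canalyzing:
  fixes S :: "'n::finite \<Rightarrow> 'a::finite set" and b :: 'a
  shows "card (\<Inter>(i, a) \<in> Sigma UNIV S. canalyzing i a b) =
    CARD('a) ^ (\<Prod>j\<in>UNIV. CARD('a) - card (S j))"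
proof -
  have "(\<Inter>(i, a) \<in> Sigma UNIV S. canalyzing i a b) =
      {f. \<forall>x. x \<notin> {x. \<forall>j. x $ j \<in> - S j} \<longrightarrow> f x = b}"
    by (simp add: set_eq_iff canalyzing_iff) blast
  then show ?thesis
    by (simp only: card_functions_constant_outside card_vec_box)
      (simp add: Compl_eq_Diff_UNIV card_Diff_subset)
qed

lemma card_set_families:
  fixes c :: "'n::finite \<Rightarrow> nat"
  shows "card {S :: 'n \<Rightarrow> 'a::finite set. (\<lambda>j. card (S j)) = c} = (\<Prod>j\<in>UNIV. CARD('a) choose c j)"
proof -
  have "{S :: 'n \<Rightarrow> 'a set. (\<lambda>j. card (S j)) = c} = PiE UNIV (\<lambda>j. {X. X \<subseteq> UNIV \<and> card X = c j})"
    by (auto simp: PiE_UNIV_domain Pi_iff)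
  then show ?thesis
    by (simp only: card_PiE finite n_subsets)
qed

lemma sum_over_relations:
  fixes h :: "('n \<times> 'a) set \<Rightarrow> 'b::comm_monoid_add"
  shows "(\<Sum>B | B \<noteq> {}. h B) = (\<Sum>S | S \<noteq> (\<lambda>_. {}). h (Sigma UNIV S))"
proof -
  have "Sigma UNIV (\<lambda>j. B `` {j}) = B" for B :: "('n \<times> 'a) set"
    by auto
  then show ?thesis
    by (intro sum.reindex_bij_witness[where i = "Sigma UNIV" and j = "\<lambda>B j. B `` {j}"])
      (auto simp: fun_eq_iff)
qed

theorem theorem3p13:
  fixes b :: "'a::{field,finite}" and q n :: nat
  assumes "q = CARD('a)" and "n = CARD('n::finite)"
  shows "int (card (canalyzing_to b :: ('a ^ 'n \<Rightarrow> 'a) set)) =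
    (\<Sum>k = 1..n * q. (-1) ^ (k - 1) *
      (\<Sum>c :: 'n \<Rightarrow> nat | (\<Sum>j\<in>UNIV. c j) = k \<and> (\<forall>j. c j \<le> q).
        int (\<Prod>j\<in>UNIV. q choose c j) * int q ^ (\<Prod>j\<in>UNIV. q - c j)))"
proof -
  define N where "N c = (\<Sum>j\<in>UNIV. c j)" for c :: "'n \<Rightarrow> nat"
  define w where "w c = (-1) ^ (N c - 1) * int q ^ (\<Prod>j\<in>UNIV. q - c j)" for c :: "'n \<Rightarrow> nat"
  define P where "P c = int (\<Prod>j\<in>UNIV. q choose c j)" for c :: "'n \<Rightarrow> nat"
  \<comment> \<open>\<open>N c \<noteq> 0\<close> mirrors the absence of the empty family from
    inclusion-exclusion.\<close>
  define C where "C = {c :: 'n \<Rightarrow> nat. N c \<noteq> 0 \<and> (\<forall>j. c j \<le> q)}"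
  let ?G = "\<lambda>(i, a). canalyzing i a b :: ('a ^ 'n \<Rightarrow> 'a) set"
  let ?card = "\<lambda>(S :: 'n \<Rightarrow> 'a set) j. card (S j)"
  have C_eq: "C = {c \<in> PiE UNIV (\<lambda>_. {..q}). N c \<noteq> 0}"
    by (auto simp: C_def PiE_UNIV_domain)
  have fin: "finite C"
    unfolding C_eq by (simp add: finite_PiE)
  have range: "N c \<in> {1..n * q}" if "c \<in> C" for c
    using that sum_bounded_above[of UNIV c q]
    by (simp add: C_def N_def assms(2) Suc_le_eq del: sum_eq_0_iff)
  have nonempty: "N (?card S) \<noteq> 0 \<longleftrightarrow> S \<noteq> (\<lambda>_. {})" for S
    by (auto simp: N_def fun_eq_iff)
  have image: "?card ` {S. S \<noteq> (\<lambda>_. {})} \<subseteq> C"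
    by (simp only: C_def assms(1) image_subset_iff nonempty mem_Collect_eq) (simp add: card_mono)
  \<comment> \<open>Inclusion-exclusion yields the exponent \<open>m + 1\<close>, the goal has
    \<open>m - 1\<close>. The parities agree except at \<open>m = 0\<close>, where subtraction
    truncates.\<close>
  have sign: "(-1 :: int) ^ (m + 1) = (-1) ^ (m - 1)" if "m \<noteq> 0" for m :: nat
    using that by (cases m) auto
  have "canalyzing_to b = (\<Union>p\<in>UNIV. ?G p)"
    by (auto simp: canalyzing_to_def)
  \<comment> \<open>Inclusion-exclusion holds for any additive set function; cardinality is one
    because all sets of functions here are finite.\<close>
  then have "int (card (canalyzing_to b :: ('a ^ 'n \<Rightarrow> 'a) set)) =
      (\<Sum>B | B \<noteq> {}. (-1) ^ (card B + 1) * int (card (\<Inter>(?G ` B))))"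
    using Incl_Excl_UN[of "\<lambda>X. int (card X)" UNIV ?G] by (simp add: card_Un_disjnt)
  also have "\<dots> = (\<Sum>S | S \<noteq> (\<lambda>_. {}). w (?card S))"
    unfolding sum_over_relations
  proof (rule sum.cong[OF refl])
    fix S :: "'n \<Rightarrow> 'a set"
    assume "S \<in> {S. S \<noteq> (\<lambda>_. {})}"
    \<comment> \<open>The disjoint union \<open>Sigma UNIV S\<close> has \<open>N (?card S)\<close>
      elements.\<close>
    then have "(-1 :: int) ^ (card (Sigma UNIV S) + 1) = (-1) ^ (N (?card S) - 1)"
      using nonempty[of S] sign[of "N (?card S)"] by (simp add: N_def)
    then show "(-1) ^ (card (Sigma UNIV S) + 1) * int (card (\<Inter>(?G ` Sigma UNIV S))) = w (?card S)"
      by (simp only: card_Inter_canalyzing w_def assms(1) of_nat_power)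
  qed
  also have "\<dots> = (\<Sum>c\<in>C. \<Sum>S | S \<in> {S. S \<noteq> (\<lambda>_. {})} \<and> ?card S = c. w (?card S))"
    by (rule sum.group[OF _ fin image, symmetric]) simp
  also have "\<dots> = (\<Sum>c\<in>C. P c * w c)"
  proof (rule sum.cong[OF refl])
    fix c
    assume "c \<in> C"
    \<comment> \<open>As \<open>N c \<noteq> 0\<close>, no family with profile \<open>c\<close> was
      excluded, so the whole class is counted by \<open>card_set_families\<close>.\<close>
    then have "S \<noteq> (\<lambda>_. {})" if "?card S = c" for S
      using nonempty[of S] that by (simp add: C_def)
    then have "{S. S \<in> {S. S \<noteq> (\<lambda>_. {})} \<and> ?card S = c} = {S. ?card S = c}"
      by (intro Collect_cong) (unfold mem_Collect_eq, metis)
    moreover have "(\<Sum>S | ?card S = c. w (?card S)) = (\<Sum>S | ?card S = c. w c)"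
      by (rule sum.cong) auto
    ultimately show "(\<Sum>S | S \<in> {S. S \<noteq> (\<lambda>_. {})} \<and> ?card S = c. w (?card S)) = P c * w c"
      by (simp add: card_set_families P_def assms(1))
  qed
  also have "\<dots> = (\<Sum>k = 1..n * q. \<Sum>c | c \<in> C \<and> N c = k. P c * w c)"
    by (rule sum.group[symmetric]) (use fin range in auto)
  \<comment> \<open>Since \<open>k \<ge> 1\<close>, \<open>N c = k\<close> already implies
    \<open>N c \<noteq> 0\<close>, and the sign is constant on the inner sum.\<close>
  also have "\<dots> = (\<Sum>k = 1..n * q. (-1) ^ (k - 1) *
      (\<Sum>c | N c = k \<and> (\<forall>j. c j \<le> q). P c * int q ^ (\<Prod>j\<in>UNIV. q - c j)))"
    unfolding sum_distrib_left
    by (intro sum.cong refl) (auto simp: C_def w_def)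
  finally show ?thesis
    by (simp only: N_def P_def)
qed

end
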